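(* Let $p_i,q_i,r_i$ ($i=1,2$) be nonzero rational numbers and put \begin{align*} U&=(r_1^2+r_2^2)p_1q_1q_2+(q_1^2r_2-2q_1q_2r_1-q_2^2r_2)p_2r_2,\\ V&=(r_1^2+r_2^2)p_1q_1q_2+(q_1^2r_1+2q_1q_2r_2-q_2^2r_1)p_2r_1,\\ W&=(p_1q_2+p_2q_1)(p_1q_1-p_2q_2),\\ S&=2p_1q_1q_2+(q_1^2-q_2^2)p_2,\qquad T=(r_1^2-r_2^2)p_1-2p_2r_1r_2, \end{align*} \begin{align*} a&=q_1q_2(p_1^2+p_2^2)UV,\\ b&=p_1p_2(q_1^2+q_2^2)UV,\\ c&=W\{(r_1^2+r_2^2)^2p_1^2q_1^2q_2^2+4(q_1r_1+q_2r_2)(q_1r_2-q_2r_1)q_1q_2r_1r_2p_1p_2+(q_1^2+q_2^2)^2p_2^2r_1^2r_2^2\},\\ d&=q_1q_2(r_1^2+r_2^2)WST,\\ e&=WUV,\\ f&=q_1q_2\{(r_1^2+r_2^2)^2p_1^4q_1^2q_2^2\\ &\quad+2(q_1^2r_1^4+q_1^2r_2^4+2q_1q_2r_1^3r_2-2q_1q_2r_1r_2^3-q_2^2r_1^4-q_2^2r_2^4)p_1^3p_2q_1q_2\\ &\quad+(q_1^4r_1^4-q_1^4r_1^2r_2^2+q_1^4r_2^4-q_1^2q_2^2r_1^4-8q_1^2q_2^2r_1^2r_2^2-q_1^2q_2^2r_2^4+q_2^4r_1^4-q_2^4r_1^2r_2^2+q_2^4r_2^4)p_1^2p_2^2\\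 &\quad-2(q_1^4r_1^2-q_1^4r_2^2+2q_1^3q_2r_1r_2-2q_1q_2^3r_1r_2+q_2^4r_1^2-q_2^4r_2^2)p_1p_2^3r_1r_2\\ &\quad+(q_1^2+q_2^2)^2p_2^4r_1^2r_2^2\}, \end{align*} and \begin{align*} x_1&=q_1q_2(p_1^2-p_2^2)UV,& y_1&=2p_1p_2q_1q_2UV,\\ x_2&=q_1q_2(r_1^2-r_2^2)WST,& y_2&=-2q_1q_2r_1r_2WST. \end{align*} If $a,b,c,d,e,f$, $-y_1y_2$, $-(y_1-y_2)(x_1y_2-x_2y_1)$ and $(y_1-y_2)(ey_1-ey_2+x_1y_2-x_2y_1)$ are all positive, then there is a rational convex quadrilateral $OABC$ with sides $OA=a$, $AB=b$, $BC=c$, $OC=d$ and diagonals $OB=e$, $AC=f$ (namely with vertices $O=(0,0)$, $A=(x_1,y_1)$, $B=(e,0)$, $C=(x_2,y_2)$), and its area is the absolute value of \begin{align*} &q_1q_2\,WUV\{2p_1^2q_1q_2r_1r_2+(q_1r_2+q_2r_1)(q_1r_1-q_2r_2)p_1p_2-2p_2^2q_1q_2r_1r_2\}\\ &\times\{(r_1^2-r_2^2)p_1^2q_1q_2+(r_1^2-r_2^2)(q_1^2-q_2^2)p_1p_2-(q_1^2-q_2^2)p_2^2r_1r_2\}. \end{align*}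
   Context: A quadrilateral is called rational if the lengths of its four sides, the lengths of its two diagonals and its area are all rational numbers. $OABC$ denotes a quadrilateral with vertices in this cyclic order. *)

theory Defs
  imports "HOL-Analysis.Analysis"
begin

text \<open>The point \<open>O\<close> is written \<open>P\<close>, because \<open>O\<close> is the infix for relation composition.\<close>

definition quad_path :: "real^2 \<Rightarrow> real^2 \<Rightarrow> real^2 \<Rightarrow> real^2 \<Rightarrow> real \<Rightarrow> real^2" where
  "quad_path P A B C = linepath P A +++ linepath A B +++ linepath B C +++ linepath C P"

definition quadrilateral :: "real^2 \<Rightarrow> real^2 \<Rightarrow> real^2 \<Rightarrow> real^2 \<Rightarrow> bool" where
  "quadrilateral P A B C \<longleftrightarrow>
     simple_path (quad_path P A B C) \<and>
     \<not> collinear {P, A, B} \<and> \<not> collinear {A, B, C} \<and> \<not> collinear {B, C, P} \<and> \<not> collinear {C, P, A}"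

definition quad_region :: "real^2 \<Rightarrow> real^2 \<Rightarrow> real^2 \<Rightarrow> real^2 \<Rightarrow> (real^2) set" where
  "quad_region P A B C =
     path_image (quad_path P A B C) \<union> inside (path_image (quad_path P A B C))"

definition convex_quadrilateral :: "real^2 \<Rightarrow> real^2 \<Rightarrow> real^2 \<Rightarrow> real^2 \<Rightarrow> bool" where
  "convex_quadrilateral P A B C \<longleftrightarrow> quadrilateral P A B C \<and> convex (quad_region P A B C)"

definition quad_area :: "real^2 \<Rightarrow> real^2 \<Rightarrow> real^2 \<Rightarrow> real^2 \<Rightarrow> real" where
  "quad_area P A B C = measure lebesgue (quad_region P A B C)"

definition rational_quadrilateral :: "real^2 \<Rightarrow> real^2 \<Rightarrow> real^2 \<Rightarrow> real^2 \<Rightarrow> bool" where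
  "rational_quadrilateral P A B C \<longleftrightarrow>
     quadrilateral P A B C \<and>
     dist P A \<in> \<rat> \<and> dist A B \<in> \<rat> \<and> dist B C \<in> \<rat> \<and> dist C P \<in> \<rat> \<and>
     dist P B \<in> \<rat> \<and> dist A C \<in> \<rat> \<and>
     quad_area P A B C \<in> \<rat>"

end

theory Submission
  imports Defs
begin

text \<open>
  Read in the complex plane, with \<open>O\<close> (the point \<open>P\<close> of the formal text) at the origin,
  five of the six connecting vectors are real multiples of squares of Gaussian rationals:
  \<open>A = q1 q2 U V (p1 + i p2)\<^sup>2\<close>, \<open>A - B = p1 p2 U V (q2 + i q1)\<^sup>2\<close>,
  \<open>B - C = W (r1 r2 S + i q1 q2 T)\<^sup>2\<close>, \<open>C = q1 q2 W S T (r1 - i r2)\<^sup>2\<close> and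
  \<open>A - C = q1 q2 (F + i G)\<^sup>2\<close>, where \<open>F\<close> and \<open>G\<close> are the two quadratic forms in \<open>p1, p2\<close>
  that occur as factors of the area; the sixth vector, \<open>B = e\<close>, is real.
  The modulus of \<open>k (m + i n)\<^sup>2\<close> is \<open>\<bar>k\<bar> (m\<^sup>2 + n\<^sup>2)\<close>, so the six lengths are rational,
  and they are the given polynomials up to sign; positivity fixes the sign. The square for
  \<open>B - C\<close> rests on \<open>U = r2\<^sup>2 S + q1 q2 T\<close> and \<open>V = r1\<^sup>2 S - q1 q2 T\<close>, which turn
  \<open>U V - q1 q2 (r1\<^sup>2 - r2\<^sup>2) S T\<close> into a difference of two squares; the square for \<open>A - C\<close> is
  \<open>diagonal_AC_square\<close>.

  The triangles \<open>OAB\<close> and \<open>OBC\<close> have the base \<open>OB\<close> on the first axis and the heights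
  \<open>\<bar>y1\<bar>\<close> and \<open>\<bar>y2\<bar>\<close> on opposite sides of it, so the area is \<open>e \<bar>y1 - y2\<bar> / 2\<close>. The imaginary
  part of \<open>A - C\<close> is \<open>y1 - y2 = 2 q1 q2 F G\<close>, which is why the area factors.

  The last three positivity hypotheses say that the line \<open>AC\<close> meets the first axis strictly
  between \<open>O\<close> and \<open>B\<close>, with \<open>A\<close> and \<open>C\<close> on opposite sides of the axis. Equivalently the
  four triangles on consecutive vertices are oriented alike. For such a quadrilateral the hull of
  the vertices is the intersection of the four half-planes bounded by its sides, the frontier of
  the hull is the polygonal path, and the inside of the frontier of a bounded convex set is its
  interior; so the region is the hull, and a diagonal cuts it into two triangles
  (\<open>ccw_quad_hull\<close>, \<open>frontier_ccw_quad\<close>, \<open>ccw_quad_area\<close>).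
\<close>

section \<open>Orientation of triples in the plane\<close>

text \<open>Twice the signed area of the triangle \<open>P Q R\<close>, positive when the triple runs
  counterclockwise, that is, when \<open>R\<close> lies to the left of the directed line \<open>P Q\<close>.\<close>

definition orient :: "real^2 \<Rightarrow> real^2 \<Rightarrow> real^2 \<Rightarrow> real" where
  "orient P Q R = (Q$1 - P$1) * (R$2 - P$2) - (Q$2 - P$2) * (R$1 - P$1)"

lemma orient_cyclic: "orient Q R P = orient P Q R"
  by (simp add: orient_def algebra_simps)

lemma orient_swap: "orient Q P R = - orient P Q R"
  by (simp add: orient_def algebra_simps)

lemma orient_degenerate [simp]: "orient P P R = 0" "orient P Q P = 0" "orient P Q Q = 0"
  by (simp_all add: orient_def)

lemma orient_affine:
  assumes "u + v + w = 1"
  shows "orient P Q (u *\<^sub>R X + v *\<^sub>R Y + w *\<^sub>R Z)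
       = u * orient P Q X + v * orient P Q Y + w * orient P Q Z"
proof -
  have u: "u = 1 - v - w" using assms by simp
  show ?thesis unfolding u orient_def by (simp add: algebra_simps)
qed

lemma orient_on_segment:
  assumes "z \<in> closed_segment P Q"
  shows "orient P Q z = 0"
proof -
  obtain u where z: "z = (1 - u) *\<^sub>R P + u *\<^sub>R Q"
    using assms unfolding closed_segment_def by blast
  show ?thesis
    unfolding z orient_def by (simp add: algebra_simps)
qed

text \<open>The half-planes on the two sides of \<open>P Q\<close> in the form in which the library knows
  half-spaces: the normal is \<open>Q - P\<close> turned left by a right angle.\<close>

lemma orient_eq_inner:
  "orient P Q R = vector [P$2 - Q$2, Q$1 - P$1] \<bullet> R - vector [P$2 - Q$2, Q$1 - P$1] \<bullet> P"
  by (simp add: orient_def inner_vec_def sum_2 vector_2 algebra_simps)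

lemma orient_normal_nonzero:
  fixes P Q :: "real^2"
  assumes "P \<noteq> Q"
  shows "vector [P$2 - Q$2, Q$1 - P$1] \<noteq> (0 :: real^2)"
  using assms by (auto simp: vec_eq_iff forall_2 vector_2)

lemma interior_orient_halfplane:
  assumes "P \<noteq> Q"
  shows "interior {z. orient P Q z \<ge> 0} = {z. orient P Q z > 0}"
  using interior_halfspace_ge[OF orient_normal_nonzero[OF assms]]
  unfolding orient_eq_inner by simp

lemma convex_orient_halfplane: "convex {z. orient P Q z \<ge> 0}"
  unfolding orient_eq_inner using convex_halfspace_ge by simp

lemma negligible_orient_line:
  assumes "P \<noteq> Q"
  shows "negligible {z. orient P Q z = 0}"
  unfolding orient_eq_inner
  using negligible_hyperplane[OF disjI1, OF orient_normal_nonzero[OF assms]] by simp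

lemma not_collinear_if_orient:
  assumes "orient P Q R \<noteq> 0"
  shows "\<not> collinear {P, Q, R}"
proof
  assume "collinear {P, Q, R}"
  then consider "P = R" | u where "Q = u *\<^sub>R P + (1 - u) *\<^sub>R R"
    unfolding collinear_3_expand by blast
  then have "orient P Q R = 0"
  proof cases
    case 1
    then show ?thesis by simp
  next
    case 2
    show ?thesis unfolding 2 orient_def by (simp add: algebra_simps)
  qed
  with assms show False by simp
qed

section \<open>Triangles\<close>

text \<open>The three orientations of \<open>z\<close> against the sides, divided by that of the triangle, are
  the barycentric coordinates of \<open>z\<close>.\<close>

lemma triangle_eq_halfplanes:
  assumes pos: "orient P A B > 0"
  shows "convex hull {P, A, B} = {z. orient P A z \<ge> 0 \<and> orient A B z \<ge> 0 \<and> orient B P z \<ge> 0}"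
    (is "?T = ?H")
proof
  have "convex ?H"
    using convex_Int[OF convex_orient_halfplane[of P A]
        convex_Int[OF convex_orient_halfplane[of A B] convex_orient_halfplane[of B P]]]
    by (simp add: Int_def)
  moreover have "{P, A, B} \<subseteq> ?H"
    using pos orient_cyclic[of P A B] orient_cyclic[of A B P] by auto
  ultimately show "?T \<subseteq> ?H"
    by (intro hull_minimal)
next
  show "?H \<subseteq> ?T"
  proof
    fix z assume z: "z \<in> ?H"
    let ?d = "orient P A B"
    define u v w where "u = orient A B z / ?d" and "v = orient B P z / ?d" and "w = orient P A z / ?d"
    have "u \<ge> 0" "v \<ge> 0" "w \<ge> 0"
      using z pos by (auto simp: u_def v_def w_def)
    moreover have "orient A B z + orient B P z + orient P A z = ?d"
      by (simp add: orient_def algebra_simps)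
    then have "u + v + w = 1"
      using pos by (simp add: u_def v_def w_def flip: add_divide_distrib)
    moreover have "?d *\<^sub>R z = orient A B z *\<^sub>R P + orient B P z *\<^sub>R A + orient P A z *\<^sub>R B"
      by (simp add: vec_eq_iff forall_2 orient_def algebra_simps)
    then have "(1 / ?d) *\<^sub>R (?d *\<^sub>R z) = u *\<^sub>R P + v *\<^sub>R A + w *\<^sub>R B"
      by (simp add: u_def v_def w_def scaleR_add_right)
    then have "z = u *\<^sub>R P + v *\<^sub>R A + w *\<^sub>R B"
      using pos by simp
    ultimately show "z \<in> ?T"
      unfolding convex_hull_3 by blast
  qed
qed

lemma measure_triangle:
  "measure lebesgue (convex hull {P, A, B}) = \<bar>orient P A B\<bar> / 2"
proof -
  have "closed (convex hull {P, A, B})"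
    by (intro compact_imp_closed finite_imp_compact_convex_hull) simp
  then have "measure lebesgue (convex hull {P, A, B}) = measure lborel (convex hull {P, A, B})"
    by (simp add: measure_completion)
  also have "\<dots> = \<bar>orient P A B\<bar> / 2"
    by (simp add: content_triangle orient_def abs_minus_commute algebra_simps)
  finally show ?thesis .
qed

section \<open>Convex quadrilaterals traversed counterclockwise\<close>

definition ccw_quad :: "real^2 \<Rightarrow> real^2 \<Rightarrow> real^2 \<Rightarrow> real^2 \<Rightarrow> bool" where
  "ccw_quad P A B C \<longleftrightarrow>
     orient P A B > 0 \<and> orient A B C > 0 \<and> orient B C P > 0 \<and> orient C P A > 0"

lemma ccw_quad_rotate: "ccw_quad P A B C \<Longrightarrow> ccw_quad A B C P"
  by (simp add: ccw_quad_def)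

text \<open>Each of the four conditions says that a vertex lies to the left of a side through two
  others, and cyclic rotation makes it usable for every side of the triangle concerned.\<close>

lemma ccw_quad_orients:
  assumes "ccw_quad P A B C"
  shows "orient P A B > 0" "orient P A C > 0" "orient A B C > 0" "orient A B P > 0"
    "orient B C P > 0" "orient B C A > 0" "orient C P A > 0" "orient C P B > 0"
    "orient P B C > 0" "orient B P A > 0"
proof -
  have "orient P A B > 0 \<and> orient A B C > 0 \<and> orient B C P > 0 \<and> orient C P A > 0"
    using assms unfolding ccw_quad_def .
  then show "orient P A B > 0" "orient P A C > 0" "orient A B C > 0" "orient A B P > 0"
    "orient B C P > 0" "orient B C A > 0" "orient C P A > 0" "orient C P B > 0"
    "orient P B C > 0" "orient B P A > 0"
    using orient_cyclic[of P A B] orient_cyclic[of A B C] orient_cyclic[of B C P]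
      orient_cyclic[of C P A] orient_cyclic[of A B P] orient_cyclic[of B C A]
      orient_cyclic[of C P B] orient_cyclic[of P A C] orient_cyclic[of P B C]
    by linarith+
qed

text \<open>Both equations come from one cycle of inclusions: the hull lies in the half-planes, since
  they contain the vertices; a point of the half-planes is in one triangle or the other according
  to its side of the diagonal \<open>P B\<close>; and the triangles lie in the hull.\<close>

lemma ccw_quad_hull:
  assumes ccw: "ccw_quad P A B C"
  shows "convex hull {P, A, B, C}
       = {z. orient P A z \<ge> 0 \<and> orient A B z \<ge> 0 \<and> orient B C z \<ge> 0 \<and> orient C P z \<ge> 0}"
      (is "?Q = ?H")
    and "convex hull {P, A, B, C} = convex hull {P, A, B} \<union> convex hull {P, B, C}"
      (is "_ = ?T1 \<union> ?T2")
proof -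
  note o = ccw_quad_orients[OF ccw]
  have "convex ?H"
    using convex_Int[OF convex_orient_halfplane[of P A] convex_Int[OF convex_orient_halfplane[of A B]
          convex_Int[OF convex_orient_halfplane[of B C] convex_orient_halfplane[of C P]]]]
    by (simp add: Int_def)
  moreover have "{P, A, B, C} \<subseteq> ?H"
    using o by auto
  ultimately have QH: "?Q \<subseteq> ?H"
    by (intro hull_minimal)
  have HT: "?H \<subseteq> ?T1 \<union> ?T2"
    unfolding triangle_eq_halfplanes[OF o(1)] triangle_eq_halfplanes[OF o(9)]
    using orient_swap[of P B] by auto
  have TQ: "?T1 \<union> ?T2 \<subseteq> ?Q"
    by (intro Un_least hull_mono) auto
  from QH HT TQ show "?Q = ?H" "?Q = ?T1 \<union> ?T2"
    by auto
qed

text \<open>On the hull, \<open>orient P A\<close> is a convex combination of its values at the vertices, which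
  are zero at \<open>P\<close> and \<open>A\<close> and positive at \<open>B\<close> and \<open>C\<close>; so it vanishes only where \<open>B\<close> and
  \<open>C\<close> have no weight. The other three sides follow by rotation.\<close>

lemma ccw_quad_edge:
  assumes ccw: "ccw_quad P A B C"
  shows "{z \<in> convex hull {P, A, B, C}. orient P A z = 0} = closed_segment P A"
proof
  note o = ccw_quad_orients[OF ccw]
  show "{z \<in> convex hull {P, A, B, C}. orient P A z = 0} \<subseteq> closed_segment P A"
  proof
    fix z assume "z \<in> {z \<in> convex hull {P, A, B, C}. orient P A z = 0}"
    then have "z \<in> convex hull {P, A, B} \<union> convex hull {P, B, C}" and z0: "orient P A z = 0"
      using ccw_quad_hull(2)[OF ccw] by simp_all
    then consider "z \<in> convex hull {P, A, B}" | "z \<in> convex hull {P, B, C}"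
      by blast
    then show "z \<in> closed_segment P A"
    proof cases
      case 1
      then obtain u v w where uvw: "u \<ge> 0" "v \<ge> 0" "w \<ge> 0" "u + v + w = 1"
        and z: "z = u *\<^sub>R P + v *\<^sub>R A + w *\<^sub>R B"
        unfolding convex_hull_3 by auto
      have "w * orient P A B = 0"
        using z0 orient_affine[OF uvw(4)] unfolding z by simp
      with o have "w = 0" by simp
      with uvw z have "z = (1 - v) *\<^sub>R P + v *\<^sub>R A" "v \<le> 1"
        by (simp_all flip: uvw(4))
      with uvw(2) show ?thesis
        unfolding closed_segment_def by blast
    next
      case 2
      then obtain u v w where uvw: "u \<ge> 0" "v \<ge> 0" "w \<ge> 0" "u + v + w = 1"
        and z: "z = u *\<^sub>R P + v *\<^sub>R B + w *\<^sub>R C"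
        unfolding convex_hull_3 by auto
      have "v * orient P A B + w * orient P A C = 0"
        using z0 orient_affine[OF uvw(4)] unfolding z by simp
      then have "v = 0" "w = 0"
        using o uvw by (simp_all add: add_nonneg_eq_0_iff)
      with uvw z show ?thesis by simp
    qed
  qed
next
  have "closed_segment P A \<subseteq> convex hull {P, A, B, C}"
    unfolding segment_convex_hull by (intro hull_mono) auto
  then show "closed_segment P A \<subseteq> {z \<in> convex hull {P, A, B, C}. orient P A z = 0}"
    using orient_on_segment by blast
qed

lemma path_image_quad_path:
  "path_image (quad_path P A B C)
     = closed_segment P A \<union> closed_segment A B \<union> closed_segment B C \<union> closed_segment C P"
  by (simp add: quad_path_def path_image_join Un_assoc)

text \<open>The interior of an intersection of closed half-planes is the intersection of the open
  ones, so a frontier point lies on one of the four bounding lines.\<close>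

lemma frontier_ccw_quad:
  assumes ccw: "ccw_quad P A B C"
  shows "frontier (convex hull {P, A, B, C}) = path_image (quad_path P A B C)"
proof -
  let ?Q = "convex hull {P, A, B, C}"
  note o = ccw_quad_orients[OF ccw]
  have ne: "P \<noteq> A" "A \<noteq> B" "B \<noteq> C" "C \<noteq> P"
    using o by auto
  note rot = ccw_quad_rotate[OF ccw]
  note rot2 = ccw_quad_rotate[OF rot]
  note rot3 = ccw_quad_rotate[OF rot2]
  have int: "interior ?Q
      = {z. orient P A z > 0 \<and> orient A B z > 0 \<and> orient B C z > 0 \<and> orient C P z > 0}"
  proof -
    have "?Q = {z. orient P A z \<ge> 0} \<inter> {z. orient A B z \<ge> 0} \<inter> {z. orient B C z \<ge> 0}
        \<inter> {z. orient C P z \<ge> 0}"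
      unfolding ccw_quad_hull(1)[OF ccw] by auto
    then show ?thesis
      using ne by (auto simp: interior_orient_halfplane)
  qed
  have "closed ?Q"
    by (intro compact_imp_closed finite_imp_compact_convex_hull) simp
  then have "frontier ?Q
      = ?Q - {z. orient P A z > 0 \<and> orient A B z > 0 \<and> orient B C z > 0 \<and> orient C P z > 0}"
    by (simp add: frontier_def int)
  also have "\<dots> = {z \<in> ?Q. orient P A z = 0} \<union> {z \<in> ?Q. orient A B z = 0}
      \<union> {z \<in> ?Q. orient B C z = 0} \<union> {z \<in> ?Q. orient C P z = 0}"
    unfolding ccw_quad_hull(1)[OF ccw] by auto
  also have "\<dots> = path_image (quad_path P A B C)"
    using ccw_quad_edge[OF ccw] ccw_quad_edge[OF rot] ccw_quad_edge[OF rot2] ccw_quad_edge[OF rot3]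
    unfolding path_image_quad_path by (simp add: insert_commute)
  finally show ?thesis .
qed

lemma ccw_quad_region:
  assumes "ccw_quad P A B C"
  shows "quad_region P A B C = convex hull {P, A, B, C}"
proof -
  let ?Q = "convex hull {P, A, B, C}"
  have "compact ?Q"
    by (intro finite_imp_compact_convex_hull) simp
  then have "closed ?Q" "bounded ?Q"
    by (auto simp: compact_eq_bounded_closed)
  have "quad_region P A B C = frontier ?Q \<union> interior ?Q"
    unfolding quad_region_def frontier_ccw_quad[OF assms, symmetric]
    by (simp add: inside_frontier_eq_interior[OF \<open>bounded ?Q\<close>])
  also have "\<dots> = ?Q"
    using \<open>closed ?Q\<close> interior_subset by (auto simp: frontier_def)
  finally show ?thesis .
qed

lemma ccw_quad_area:
  assumes ccw: "ccw_quad P A B C"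
  shows "quad_area P A B C = (orient P A B + orient P B C) / 2"
proof -
  let ?T1 = "convex hull {P, A, B}" and ?T2 = "convex hull {P, B, C}"
  note o = ccw_quad_orients[OF ccw]
  have "P \<noteq> B" using o by auto
  have "?T1 \<inter> ?T2 \<subseteq> {z. orient P B z = 0}"
    unfolding triangle_eq_halfplanes[OF o(1)] triangle_eq_halfplanes[OF o(9)]
    using orient_swap[of P B] by auto
  then have "negligible (?T1 \<inter> ?T2)"
    using negligible_orient_line[OF \<open>P \<noteq> B\<close>] negligible_subset by blast
  moreover have "?T1 \<in> lmeasurable" "?T2 \<in> lmeasurable"
    by (intro lmeasurable_compact finite_imp_compact_convex_hull; simp)+
  ultimately have "measure lebesgue (?T1 \<union> ?T2) = measure lebesgue ?T1 + measure lebesgue ?T2"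
    by (simp add: measure_Un3 negligible_imp_measure0)
  then show ?thesis
    unfolding quad_area_def ccw_quad_region[OF ccw] ccw_quad_hull(2)[OF ccw] measure_triangle
    using o by simp
qed

text \<open>Separation by the line \<open>P A\<close>, which carries one segment and keeps the other strictly
  on its left.\<close>

lemma opposite_edges_disjoint:
  assumes "orient P A B > 0" "orient P A C > 0"
  shows "closed_segment P A \<inter> closed_segment B C = {}"
proof -
  have "convex {z. orient P A z > 0}"
    unfolding orient_eq_inner using convex_halfspace_gt by simp
  then have "closed_segment B C \<subseteq> {z. orient P A z > 0}"
    using assms by (intro closed_segment_subset) auto
  then have "orient P A z > 0" if "z \<in> closed_segment B C" for z
    using that by blast
  then show ?thesis
    using orient_on_segment by (metis disjoint_iff less_irrefl)
qed

lemma ccw_quad_quadrilateral: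
  assumes ccw: "ccw_quad P A B C"
  shows "quadrilateral P A B C"
proof -
  note o = ccw_quad_orients[OF ccw]
  have nc: "\<not> collinear {P, A, B}" "\<not> collinear {A, B, C}" "\<not> collinear {B, C, P}" "\<not> collinear {C, P, A}"
    using o by (simp_all add: not_collinear_if_orient)
  note adj = nc[THEN disjI2, THEN Int_closed_segment]
  have opp: "closed_segment P A \<inter> closed_segment B C = {}"
    "closed_segment A B \<inter> closed_segment C P = {}"
    using o by (simp_all add: opposite_edges_disjoint)
  have ne: "P \<noteq> A" "A \<noteq> B" "B \<noteq> C" "C \<noteq> P"
    using o by auto
  have arcBP: "arc (linepath B C +++ linepath C P)"
    using ne adj(3) by (intro arc_join) simp_all
  have arcAP: "arc (linepath A B +++ linepath B C +++ linepath C P)"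
  proof (rule arc_join)
    show "path_image (linepath A B) \<inter> path_image (linepath B C +++ linepath C P)
        \<subseteq> {pathstart (linepath B C +++ linepath C P)}"
      using adj(2) opp(2) by (simp add: path_image_join Int_Un_distrib)
  qed (use ne arcBP in simp_all)
  have "simple_path (quad_path P A B C)"
    unfolding quad_path_def
  proof (rule simple_path_join_loop)
    have "closed_segment P A \<inter> closed_segment C P = {P}"
      using adj(4) by (simp add: Int_commute)
    then show "path_image (linepath P A) \<inter> path_image (linepath A B +++ linepath B C +++ linepath C P)
        \<subseteq> {pathstart (linepath P A), pathstart (linepath A B +++ linepath B C +++ linepath C P)}"
      using adj(1) opp(1) by (simp add: path_image_join Int_Un_distrib)
  qed (use ne arcAP in simp_all)
  with nc show ?thesis
    unfolding quadrilateral_def by simp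
qed

section \<open>Quadrilaterals with a diagonal on the first axis\<close>

text \<open>Reversal carries the results on counterclockwise quadrilaterals over to clockwise ones.\<close>

lemma quad_region_reverse: "quad_region P C B A = quad_region P A B C"
proof -
  have "path_image (quad_path P C B A) = path_image (quad_path P A B C)"
    unfolding path_image_quad_path by (auto simp: closed_segment_commute)
  then show ?thesis
    unfolding quad_region_def by simp
qed

lemma quadrilateral_reverse:
  assumes "quadrilateral P C B A"
  shows "quadrilateral P A B C"
proof -
  have "reversepath (quad_path P C B A)
      = ((linepath P A +++ linepath A B) +++ linepath B C) +++ linepath C P"
    unfolding quad_path_def by (simp add: reversepath_joinpaths)
  then have "simple_path (((linepath P A +++ linepath A B) +++ linepath B C) +++ linepath C P)"
    using assms simple_path_reversepath unfolding quadrilateral_def by metis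
  then have "simple_path (quad_path P A B C)"
    unfolding quad_path_def by (simp add: simple_path_assoc)
  with assms show ?thesis
    unfolding quadrilateral_def by (simp add: insert_commute)
qed

text \<open>The orientations of the triples of consecutive vertices are, up to sign, \<open>e y1\<close>, \<open>e y2\<close>
  and the two expressions that are multiplied by \<open>y1 - y2\<close> in the hypotheses. As \<open>y1\<close>, \<open>- y2\<close>
  and \<open>y1 - y2\<close> have the same sign, the hypotheses make all four orientations agree; the
  traversal is clockwise exactly when \<open>y1 > 0\<close>.\<close>

lemma convex_quadrilateral_split_by_axis:
  fixes x1 y1 x2 y2 e :: real
  defines "P \<equiv> vector [0, 0] :: real^2" and "A \<equiv> vector [x1, y1]"
    and "B \<equiv> vector [e, 0]" and "C \<equiv> vector [x2, y2]"
  assumes "e > 0" "- y1*y2 > 0"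
    "- (y1 - y2)*(x1*y2 - x2*y1) > 0"
    "(y1 - y2)*(e*y1 - e*y2 + x1*y2 - x2*y1) > 0"
  shows "convex_quadrilateral P A B C" and "quad_area P A B C = \<bar>e * (y1 - y2)\<bar> / 2"
proof -
  have orients:
    "orient P A B = - (e * y1)" "orient P B C = e * y2" "orient P C B = - (e * y2)" "orient P B A = e * y1"
    "orient A B C = - (e*y1 - e*y2 + x1*y2 - x2*y1)" "orient C B A = e*y1 - e*y2 + x1*y2 - x2*y1"
    "orient B C P = e * y2" "orient B A P = e * y1"
    "orient C P A = x1*y2 - x2*y1" "orient A P C = - (x1*y2 - x2*y1)"
    by (simp_all add: orient_def P_def A_def B_def C_def vector_2 algebra_simps)
  consider "y1 < 0" "y2 > 0" | "y1 > 0" "y2 < 0"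
    using \<open>- y1*y2 > 0\<close> by (auto simp: mult_less_0_iff)
  then have "convex_quadrilateral P A B C \<and> quad_area P A B C = \<bar>e * (y1 - y2)\<bar> / 2"
  proof cases
    case 1
    then have "y1 - y2 < 0" by simp
    have ccw: "ccw_quad P A B C"
      unfolding ccw_quad_def orients
      using 1 \<open>y1 - y2 < 0\<close> assms(5-) by (auto simp: zero_less_mult_iff mult_less_0_iff)
    have "e * y1 < 0" "e * y2 > 0"
      using 1 \<open>e > 0\<close> by (simp_all add: mult_less_0_iff)
    with ccw show ?thesis
      unfolding convex_quadrilateral_def
      by (simp add: ccw_quad_quadrilateral ccw_quad_region ccw_quad_area orients right_diff_distrib)
  next
    case 2
    then have "y1 - y2 > 0" by simp
    have ccw: "ccw_quad P C B A"
      unfolding ccw_quad_def orients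
      using 2 \<open>y1 - y2 > 0\<close> assms(5-) by (auto simp: zero_less_mult_iff mult_less_0_iff)
    have "e * y1 > 0" "e * y2 < 0"
      using 2 \<open>e > 0\<close> by (simp_all add: mult_less_0_iff)
    moreover have "quad_region P A B C = convex hull {P, C, B, A}"
      using ccw_quad_region[OF ccw] quad_region_reverse by metis
    moreover have "quad_area P A B C = quad_area P C B A"
      unfolding quad_area_def by (metis quad_region_reverse)
    ultimately show ?thesis
      unfolding convex_quadrilateral_def
      using quadrilateral_reverse[OF ccw_quad_quadrilateral[OF ccw]] ccw_quad_area[OF ccw]
      by (simp add: orients right_diff_distrib)
  qed
  then show "convex_quadrilateral P A B C" "quad_area P A B C = \<bar>e * (y1 - y2)\<bar> / 2"
    by auto
qed


section \<open>The rational parametrization\<close>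

text \<open>The modulus of the complex number \<open>k (m + i n)\<^sup>2\<close>, written in real coordinates.\<close>

lemma dist_if_square_multiple:
  fixes x y x' y' k m n :: real
  assumes "x - x' = k * (m^2 - n^2)" "y - y' = 2 * k * m * n"
  shows "dist (vector [x, y] :: real^2) (vector [x', y']) = \<bar>k * (m^2 + n^2)\<bar>"
proof -
  have "(x - x')^2 + (y - y')^2 = (k * (m^2 + n^2))^2"
    unfolding assms by algebra
  then show ?thesis
    by (simp add: dist_vec_def L2_set_def sum_2 vector_2 dist_real_def)
qed

text \<open>The two equations are the real and (halved) imaginary parts of
  \<open>(p1 + i p2)\<^sup>2 U V - (r1 - i r2)\<^sup>2 W S T = (F + i G)\<^sup>2\<close>, whose left-hand side is
  \<open>(A - C) / (q1 q2)\<close>. The second one also accounts for the factorization of the area.\<close>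

lemma diagonal_AC_square:
  fixes p1 p2 q1 q2 r1 r2 U V W S T F G :: real
  assumes U: "U = r2^2 * S + q1*q2 * T" and V: "V = r1^2 * S - q1*q2 * T"
    and W: "W = (p1*q2 + p2*q1)*(p1*q1 - p2*q2)"
    and S: "S = 2*p1*q1*q2 + (q1^2 - q2^2)*p2"
    and T: "T = (r1^2 - r2^2)*p1 - 2*p2*r1*r2"
    and F: "F = 2*p1^2*q1*q2*r1*r2 + (q1*r2 + q2*r1)*(q1*r1 - q2*r2)*p1*p2 - 2*p2^2*q1*q2*r1*r2"
    and G: "G = (r1^2 - r2^2)*p1^2*q1*q2 + (r1^2 - r2^2)*(q1^2 - q2^2)*p1*p2
              - (q1^2 - q2^2)*p2^2*r1*r2"
  shows "(p1^2 - p2^2)*U*V - (r1^2 - r2^2)*W*S*T = F^2 - G^2"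
    and "p1*p2*U*V + r1*r2*W*S*T = F * G"
  unfolding F G U V W S T by algebra+

theorem mainTheorem4:
  fixes p1 p2 q1 q2 r1 r2 U V W S T a b c d e f x1 y1 x2 y2 :: real
  assumes rat: "p1 \<in> \<rat>" "p2 \<in> \<rat>" "q1 \<in> \<rat>" "q2 \<in> \<rat>" "r1 \<in> \<rat>" "r2 \<in> \<rat>"
    and nonzero: "p1 \<noteq> 0" "p2 \<noteq> 0" "q1 \<noteq> 0" "q2 \<noteq> 0" "r1 \<noteq> 0" "r2 \<noteq> 0"
    and U: "U = (r1^2 + r2^2)*p1*q1*q2 + (q1^2*r2 - 2*q1*q2*r1 - q2^2*r2)*p2*r2"
    and V: "V = (r1^2 + r2^2)*p1*q1*q2 + (q1^2*r1 + 2*q1*q2*r2 - q2^2*r1)*p2*r1"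
    and W: "W = (p1*q2 + p2*q1)*(p1*q1 - p2*q2)"
    and S: "S = 2*p1*q1*q2 + (q1^2 - q2^2)*p2"
    and T: "T = (r1^2 - r2^2)*p1 - 2*p2*r1*r2"
    and a: "a = q1*q2*(p1^2 + p2^2)*U*V"
    and b: "b = p1*p2*(q1^2 + q2^2)*U*V"
    and c: "c = W*((r1^2 + r2^2)^2*p1^2*q1^2*q2^2
                 + 4*(q1*r1 + q2*r2)*(q1*r2 - q2*r1)*q1*q2*r1*r2*p1*p2
                 + (q1^2 + q2^2)^2*p2^2*r1^2*r2^2)"
    and d: "d = q1*q2*(r1^2 + r2^2)*W*S*T"
    and e: "e = W*U*V"
    and f: "f = q1*q2*((r1^2 + r2^2)^2*p1^4*q1^2*q2^2
                 + 2*(q1^2*r1^4 + q1^2*r2^4 + 2*q1*q2*r1^3*r2 - 2*q1*q2*r1*r2^3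
                      - q2^2*r1^4 - q2^2*r2^4)*p1^3*p2*q1*q2
                 + (q1^4*r1^4 - q1^4*r1^2*r2^2 + q1^4*r2^4 - q1^2*q2^2*r1^4
                      - 8*q1^2*q2^2*r1^2*r2^2 - q1^2*q2^2*r2^4 + q2^4*r1^4
                      - q2^4*r1^2*r2^2 + q2^4*r2^4)*p1^2*p2^2
                 - 2*(q1^4*r1^2 - q1^4*r2^2 + 2*q1^3*q2*r1*r2 - 2*q1*q2^3*r1*r2
                      + q2^4*r1^2 - q2^4*r2^2)*p1*p2^3*r1*r2
                 + (q1^2 + q2^2)^2*p2^4*r1^2*r2^2)"
    and x1: "x1 = q1*q2*(p1^2 - p2^2)*U*V"
    and y1: "y1 = 2*p1*p2*q1*q2*U*V"
    and x2: "x2 = q1*q2*(r1^2 - r2^2)*W*S*T"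
    and y2: "y2 = -2*q1*q2*r1*r2*W*S*T"
    and pos: "a > 0" "b > 0" "c > 0" "d > 0" "e > 0" "f > 0"
      "- y1*y2 > 0"
      "- (y1 - y2)*(x1*y2 - x2*y1) > 0"
      "(y1 - y2)*(e*y1 - e*y2 + x1*y2 - x2*y1) > 0"
  shows "\<exists>P A B C :: real^2.
      P = vector [0, 0] \<and> A = vector [x1, y1] \<and> B = vector [e, 0] \<and> C = vector [x2, y2] \<and>
      rational_quadrilateral P A B C \<and> convex_quadrilateral P A B C \<and>
      dist P A = a \<and> dist A B = b \<and> dist B C = c \<and> dist C P = d \<and>
      dist P B = e \<and> dist A C = f \<and>
      quad_area P A B C =
        \<bar>q1*q2*W*U*V
          * (2*p1^2*q1*q2*r1*r2 + (q1*r2 + q2*r1)*(q1*r1 - q2*r2)*p1*p2 - 2*p2^2*q1*q2*r1*r2)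
          * ((r1^2 - r2^2)*p1^2*q1*q2 + (r1^2 - r2^2)*(q1^2 - q2^2)*p1*p2
              - (q1^2 - q2^2)*p2^2*r1*r2)\<bar>"
proof -
  define F where "F = 2*p1^2*q1*q2*r1*r2 + (q1*r2 + q2*r1)*(q1*r1 - q2*r2)*p1*p2
    - 2*p2^2*q1*q2*r1*r2"
  define G where "G = (r1^2 - r2^2)*p1^2*q1*q2 + (r1^2 - r2^2)*(q1^2 - q2^2)*p1*p2
    - (q1^2 - q2^2)*p2^2*r1*r2"
  define P A B C :: "real^2"
    where "P = vector [0, 0]" and "A = vector [x1, y1]" and "B = vector [e, 0]" and "C = vector [x2, y2]"
  note quad_defs = P_def A_def B_def C_def

  have US: "U = r2^2 * S + q1*q2 * T" and VS: "V = r1^2 * S - q1*q2 * T"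
    unfolding U V S T by algebra+
  note AC = diagonal_AC_square[OF US VS W S T F_def G_def]
  have c_eq: "c = W * ((r1*r2*S)^2 + (q1*q2*T)^2)"
    unfolding c S T by algebra
  have f_eq: "f = q1*q2 * (F^2 + G^2)"
    unfolding f F_def G_def by algebra

  have "dist A P = \<bar>q1*q2*U*V * (p1^2 + p2^2)\<bar>"
    unfolding quad_defs by (rule dist_if_square_multiple) (simp_all add: x1 y1)
  then have OA: "dist P A = a"
    using pos(1) by (simp add: a dist_commute mult_ac)
  have "dist A B = \<bar>p1*p2*U*V * (q2^2 + q1^2)\<bar>"
    unfolding quad_defs
  proof (rule dist_if_square_multiple)
    show "x1 - e = p1*p2*U*V * (q2^2 - q1^2)"
      unfolding x1 e W by algebra
    show "y1 - 0 = 2 * (p1*p2*U*V) * q2 * q1"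
      unfolding y1 by simp
  qed
  then have AB: "dist A B = b"
    using pos(2) by (simp add: b mult_ac add_ac)
  have "dist B C = \<bar>W * ((r1*r2*S)^2 + (q1*q2*T)^2)\<bar>"
    unfolding quad_defs
  proof (rule dist_if_square_multiple)
    show "e - x2 = W * ((r1*r2*S)^2 - (q1*q2*T)^2)"
      unfolding e x2 US VS by algebra
    show "0 - y2 = 2 * W * (r1*r2*S) * (q1*q2*T)"
      unfolding y2 by simp
  qed
  then have BC: "dist B C = c"
    using pos(3) by (simp flip: c_eq)
  have "dist C P = \<bar>q1*q2*W*S*T * (r1^2 + (- r2)^2)\<bar>"
    unfolding quad_defs by (rule dist_if_square_multiple) (simp_all add: x2 y2)
  then have OC: "dist C P = d"
    using pos(4) by (simp add: d mult_ac)
  \<comment> \<open>The vector \<open>B\<close> is real: the square is \<open>1\<^sup>2\<close>.\<close>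
  have "dist B P = \<bar>e * (1^2 + 0^2)\<bar>"
    unfolding quad_defs by (rule dist_if_square_multiple) simp_all
  then have OB: "dist P B = e"
    using pos(5) by (simp add: dist_commute)
  have "y1 - y2 = 2 * (q1*q2) * (p1*p2*U*V + r1*r2*W*S*T)"
    unfolding y1 y2 by algebra
  then have y12: "y1 - y2 = 2 * (q1*q2) * F * G"
    unfolding AC(2) by simp
  have "dist A C = \<bar>q1*q2 * (F^2 + G^2)\<bar>"
    unfolding quad_defs
  proof (rule dist_if_square_multiple)
    have "x1 - x2 = q1*q2 * ((p1^2 - p2^2)*U*V - (r1^2 - r2^2)*W*S*T)"
      unfolding x1 x2 by algebra
    then show "x1 - x2 = q1*q2 * (F^2 - G^2)"
      unfolding AC(1) .
    show "y1 - y2 = 2 * (q1*q2) * F * G"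
      by (fact y12)
  qed
  then have ACf: "dist A C = f"
    using pos(6) by (simp flip: f_eq)

  have convex: "convex_quadrilateral P A B C"
    and area: "quad_area P A B C = \<bar>e * (y1 - y2)\<bar> / 2"
    unfolding quad_defs
    using convex_quadrilateral_split_by_axis[OF pos(5) pos(7) pos(8) pos(9)] by blast+
  have "e * (y1 - y2) = 2 * (q1*q2*W*U*V * F * G)"
    unfolding y12 e by (simp add: mult_ac)
  then have area_FG: "quad_area P A B C = \<bar>q1*q2*W*U*V * F * G\<bar>"
    unfolding area by (simp add: abs_mult)

  have "U \<in> \<rat>" "V \<in> \<rat>" "W \<in> \<rat>" "S \<in> \<rat>" "T \<in> \<rat>" "F \<in> \<rat>" "G \<in> \<rat>"
    unfolding U V W S T F_def G_def using rat by simp_all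
  then have "a \<in> \<rat>" "b \<in> \<rat>" "c \<in> \<rat>" "d \<in> \<rat>" "e \<in> \<rat>" "f \<in> \<rat>" "quad_area P A B C \<in> \<rat>"
    unfolding a b c_eq d e f_eq area_FG using rat by simp_all
  then have "rational_quadrilateral P A B C"
    using convex unfolding rational_quadrilateral_def convex_quadrilateral_def
    by (simp add: OA AB BC OC OB ACf)
  with convex OA AB BC OC OB ACf area_FG show ?thesis
    unfolding F_def G_def quad_defs by blast
qed

end
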